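(* For every integer $n\ge1$, the variance of the number $X_n$ of swaps of Quicksort for a list of length $n$ under Variant I is $$2n(n+2)-(n+1)H_1(n)-(n+1)^2H_2(n).$$
   Context: $H_k(n)=\sum_{i=1}^n \frac1{i^k}$. Variant I of Quicksort, applied to a uniformly random ordering of $n$ distinct elements: the first element of the list is the pivot; every other element is compared with the pivot and, if smaller than the pivot, it is removed and inserted before the pivot (this counts as one swap); then the procedure is applied recursively to the sublists of elements before and after the pivot. Thus partitioning costs $k-1$ swaps when the pivot is the $k$-th smallest element. $X_n$ is the total number of swaps. Formally, the probability generating function $P_n(t)=\sum_{m\ge0}P(X_n=m)t^m$ is determined by $P_0(t)=P_1(t)=1$ and $P_n(t)=\frac1n\sum_{k=1}^n P_{k-1}(t)P_{n-k}(t)\,t^{k-1}$ for $n\ge2$. *)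

theory Defs
  imports "HOL-Probability.Probability"
begin

text \<open>
  One scan over the non-pivot elements: each element smaller than the pivot p is moved to the
  part before the pivot, which costs one swap. The result consists of the part before the pivot,
  the part after the pivot, and the number of swaps.
\<close>

fun pivot_scan :: "'a::linorder \<Rightarrow> 'a list \<Rightarrow> 'a list \<times> 'a list \<times> nat" where
  "pivot_scan p [] = ([], [], 0)"
| "pivot_scan p (y # ys) =
     (case pivot_scan p ys of (bs, as, c) \<Rightarrow>
        if y < p then (y # bs, as, c + 1) else (bs, y # as, c))"

lemma pivot_scan_eq:
  "pivot_scan p xs =
     (filter (\<lambda>y. y < p) xs, filter (\<lambda>y. \<not> y < p) xs, length (filter (\<lambda>y. y < p) xs))"
  by (induction xs) auto

text \<open>Returns the sorted list together with the total number of swaps.\<close>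

function quicksort :: "'a::linorder list \<Rightarrow> 'a list \<times> nat" where
  "quicksort [] = ([], 0)"
| "quicksort (p # xs) =
     (case pivot_scan p xs of (bs, as, c) \<Rightarrow>
      case quicksort bs of (bs', c1) \<Rightarrow>
      case quicksort as of (as', c2) \<Rightarrow>
        (bs' @ p # as', c + c1 + c2))"
  by pat_completeness auto
termination
  by (relation "Wellfounded.measure length")
     (auto simp: pivot_scan_eq less_Suc_eq_le)

definition swaps :: "'a::linorder list \<Rightarrow> nat" where
  "swaps xs = snd (quicksort xs)"

text \<open>The distribution of the number of swaps for a uniformly random ordering of the set A.\<close>

definition swaps_pmf :: "'a::linorder set \<Rightarrow> nat pmf" where
  "swaps_pmf A = map_pmf swaps (pmf_of_set (permutations_of_set A))"

definition H :: "nat \<Rightarrow> nat \<Rightarrow> real" where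
  "H k n = (\<Sum>i=1..n. 1 / real i ^ k)"

definition pgf :: "nat pmf \<Rightarrow> real \<Rightarrow> real" where
  "pgf p t = (\<Sum>m. pmf p m * t ^ m)"

lemma swaps_Nil [simp]: "swaps [] = 0"
  by (simp add: swaps_def)

lemma swaps_Cons:
  "swaps (p # xs) = length (filter (\<lambda>y. y < p) xs)
     + swaps (filter (\<lambda>y. y < p) xs) + swaps (filter (\<lambda>y. \<not> y < p) xs)"
  by (simp add: swaps_def pivot_scan_eq split: prod.splits)

lemma quicksort_sorts: "fst (quicksort xs) = sort xs"
proof (induction xs rule: quicksort.induct)
  case 1
  then show ?case by simp
next
  case (2 p xs)
  have L: "fst (quicksort (filter (\<lambda>y. y < p) xs)) = sort (filter (\<lambda>y. y < p) xs)"
    by (rule "2.IH"(1)[OF pivot_scan_eq[symmetric] refl])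
  have R: "fst (quicksort (filter (\<lambda>y. \<not> y < p) xs)) = sort (filter (\<lambda>y. \<not> y < p) xs)"
    by (rule "2.IH"(2)[OF pivot_scan_eq[symmetric] refl surjective_pairing[symmetric]])
  have "fst (quicksort (p # xs)) =
      sort (filter (\<lambda>y. y < p) xs) @ p # sort (filter (\<lambda>y. \<not> y < p) xs)"
    by (simp add: pivot_scan_eq case_prod_unfold flip: L R)
  also have "\<dots> = sort (p # xs)"
  proof (rule properties_for_sort[symmetric])
    show "mset (sort (filter (\<lambda>y. y < p) xs) @ p # sort (filter (\<lambda>y. \<not> y < p) xs)) =
          mset (p # xs)"
      by simp
    show "sorted (sort (filter (\<lambda>y. y < p) xs) @ p # sort (filter (\<lambda>y. \<not> y < p) xs))"
      by (auto simp: sorted_append)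
  qed
  finally show ?case .
qed

lemma finite_set_swaps_pmf [simp]: "finite A \<Longrightarrow> finite (set_pmf (swaps_pmf A))"
  by (simp add: swaps_pmf_def)

lemma swaps_pmf_empty [simp]: "swaps_pmf {} = return_pmf 0"
  by (simp add: swaps_pmf_def pmf_of_set_singleton)

lemma swaps_pmf_rec:
  assumes "finite A" "A \<noteq> {}"
  shows "swaps_pmf A = pmf_of_set A \<bind> (\<lambda>p.
           map_pmf (\<lambda>(c1, c2). card {x\<in>A. x < p} + c1 + c2)
             (pair_pmf (swaps_pmf {x\<in>A. x < p}) (swaps_pmf {x\<in>A. x > p})))"
proof -
  have "swaps_pmf A = pmf_of_set A \<bind> (\<lambda>p.
          map_pmf (\<lambda>xs. swaps (p # xs)) (pmf_of_set (permutations_of_set (A - {p}))))"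
    using assms
    by (simp add: swaps_pmf_def random_permutation_of_set map_bind_pmf map_pmf_def
          bind_assoc_pmf bind_return_pmf)
  also have "\<dots> = pmf_of_set A \<bind> (\<lambda>p.
           map_pmf (\<lambda>(c1, c2). card {x\<in>A. x < p} + c1 + c2)
             (pair_pmf (swaps_pmf {x\<in>A. x < p}) (swaps_pmf {x\<in>A. x > p})))"
  proof (rule bind_pmf_cong[OF refl])
    fix p assume "p \<in> set_pmf (pmf_of_set A)"
    then have p: "p \<in> A" using assms by simp
    have s1: "{x \<in> A - {p}. x < p} = {x\<in>A. x < p}" by auto
    have s2: "{x \<in> A - {p}. \<not> x < p} = {x\<in>A. x > p}" by auto
    have "map_pmf (\<lambda>xs. swaps (p # xs)) (pmf_of_set (permutations_of_set (A - {p})))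
        = map_pmf (\<lambda>(bs, as). length bs + swaps bs + swaps as)
            (map_pmf (partition (\<lambda>y. y < p)) (pmf_of_set (permutations_of_set (A - {p}))))"
      by (simp add: pmf.map_comp o_def swaps_Cons)
    also have "\<dots> = map_pmf (\<lambda>(bs, as). length bs + swaps bs + swaps as)
        (pair_pmf (pmf_of_set (permutations_of_set {x\<in>A. x < p}))
                  (pmf_of_set (permutations_of_set {x\<in>A. x > p})))"
      using assms by (subst partition_random_permutations) (simp_all only: s1 s2 finite_Diff)
    also have "\<dots> = map_pmf (\<lambda>(bs, as). card {x\<in>A. x < p} + swaps bs + swaps as)
        (pair_pmf (pmf_of_set (permutations_of_set {x\<in>A. x < p}))
                  (pmf_of_set (permutations_of_set {x\<in>A. x > p})))"
      using assms
      by (intro map_pmf_cong) (auto simp: length_finite_permutations_of_set)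
    also have "\<dots> = map_pmf (\<lambda>(c1, c2). card {x\<in>A. x < p} + c1 + c2)
        (pair_pmf (swaps_pmf {x\<in>A. x < p}) (swaps_pmf {x\<in>A. x > p}))"
      by (simp add: swaps_pmf_def map_pair[symmetric] pmf.map_comp o_def case_prod_unfold)
    finally show "map_pmf (\<lambda>xs. swaps (p # xs)) (pmf_of_set (permutations_of_set (A - {p}))) = \<dots>" .
  qed
  finally show ?thesis .
qed

lemma bij_betw_rank:
  fixes A :: "'a::linorder set"
  assumes "finite A"
  shows "bij_betw (\<lambda>p. card {x\<in>A. x \<le> p}) A {1..card A}"
proof -
  have less: "card {x\<in>A. x \<le> p} < card {x\<in>A. x \<le> q}" if "p \<in> A" "q \<in> A" "p < q" for p q
  proof (rule psubset_card_mono)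
    have "q \<in> {x\<in>A. x \<le> q} - {x\<in>A. x \<le> p}" using that by auto
    then show "{x\<in>A. x \<le> p} \<subset> {x\<in>A. x \<le> q}" using that by (blast intro: order.trans less_imp_le)
  qed (use assms in simp)
  have inj: "inj_on (\<lambda>p. card {x\<in>A. x \<le> p}) A"
  proof (rule inj_onI)
    fix p q assume "p \<in> A" "q \<in> A" "card {x\<in>A. x \<le> p} = card {x\<in>A. x \<le> q}"
    then show "p = q"
      using less[of p q] less[of q p] by (cases p q rule: linorder_cases) auto
  qed
  moreover have "(\<lambda>p. card {x\<in>A. x \<le> p}) ` A \<subseteq> {1..card A}"
    using assms by (auto simp: Suc_le_eq card_gt_0_iff intro!: card_mono)
  ultimately show ?thesis
    using assms by (simp add: bij_betw_def card_image card_subset_eq)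
qed

lemma swaps_pmf_card_aux:
  fixes A :: "'a::linorder set"
  assumes "finite A" "A \<noteq> {}"
    and IH: "\<And>B. finite B \<Longrightarrow> card B < card A \<Longrightarrow> swaps_pmf (B::'a set) = swaps_pmf {1..card B}"
  shows "swaps_pmf A = pmf_of_set {1..card A} \<bind> (\<lambda>k.
           map_pmf (\<lambda>(c1, c2). (k - 1) + c1 + c2)
             (pair_pmf (swaps_pmf {1..k - 1}) (swaps_pmf {1..card A - k})))"
proof -
  let ?r = "\<lambda>p. card {x\<in>A. x \<le> p}"
  have "map_pmf ?r (pmf_of_set A) = pmf_of_set {1..card A}"
    using bij_betw_rank[OF assms(1)] assms(1,2)
    by (subst map_pmf_of_set_inj) (auto simp only: bij_betw_def)
  moreover have "swaps_pmf A = pmf_of_set A \<bind> (\<lambda>p.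
           map_pmf (\<lambda>(c1, c2). (?r p - 1) + c1 + c2)
             (pair_pmf (swaps_pmf {1..?r p - 1}) (swaps_pmf {1..card A - ?r p})))"
  proof (subst swaps_pmf_rec[OF assms(1,2)], rule bind_pmf_cong[OF refl])
    fix p assume "p \<in> set_pmf (pmf_of_set A)"
    then have p: "p \<in> A" using assms by simp
    have "{x\<in>A. x \<le> p} = insert p {x\<in>A. x < p}" using p by auto
    then have c1: "card {x\<in>A. x < p} = ?r p - 1" using assms(1) by simp
    have "{x\<in>A. x > p} = A - {x\<in>A. x \<le> p}" by auto
    then have c2: "card {x\<in>A. x > p} = card A - ?r p"
      using assms(1) by (simp add: card_Diff_subset)
    have "card {x\<in>A. x < p} < card A" "card {x\<in>A. x > p} < card A"
      using p assms(1) by (auto intro!: psubset_card_mono)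
    then have "swaps_pmf {x\<in>A. x < p} = swaps_pmf {1..?r p - 1}"
      "swaps_pmf {x\<in>A. x > p} = swaps_pmf {1..card A - ?r p}"
      using assms(1) by (simp_all add: IH c1 c2)
    then show "map_pmf (\<lambda>(c1, c2). card {x\<in>A. x < p} + c1 + c2)
             (pair_pmf (swaps_pmf {x\<in>A. x < p}) (swaps_pmf {x\<in>A. x > p})) =
          map_pmf (\<lambda>(c1, c2). (?r p - 1) + c1 + c2)
             (pair_pmf (swaps_pmf {1..?r p - 1}) (swaps_pmf {1..card A - ?r p}))"
      by (simp only: c1)
  qed
  ultimately show ?thesis
    by (simp only: bind_map_pmf flip: \<open>map_pmf ?r (pmf_of_set A) = _\<close>)
qed

text \<open>The distribution depends on the set only through its cardinality.\<close>

lemma swaps_pmf_card: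
  fixes A :: "'a::linorder set"
  assumes "finite A"
  shows "swaps_pmf A = swaps_pmf {1..card A}"
proof -
  have nat: "swaps_pmf (A::nat set) = swaps_pmf {1..card A}" if "finite A" for A
    using that
  proof (induction "card A" arbitrary: A rule: less_induct)
    case less
    show ?case
    proof (cases "A = {}")
      case False
      have "card {1..card A} = card A" by simp
      moreover have "{1..card A} \<noteq> {}" using False less.prems by (simp add: Suc_le_eq card_gt_0_iff)
      ultimately show ?thesis
        using swaps_pmf_card_aux[OF less.prems False less.hyps]
          swaps_pmf_card_aux[of "{1..card A}", OF _ _ less.hyps] by simp
    qed simp
  qed
  show ?thesis using assms
  proof (induction "card A" arbitrary: A rule: less_induct)
    case less
    show ?case
    proof (cases "A = {}")
      case False
      have "card {1..card A} = card A" by simp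
      moreover have "{1..card A} \<noteq> {}" using False less.prems by (simp add: Suc_le_eq card_gt_0_iff)
      ultimately show ?thesis
        using swaps_pmf_card_aux[OF less.prems False less.hyps]
          swaps_pmf_card_aux[of "{1..card A}", OF _ _ nat] by simp
    qed simp
  qed
qed

lemma pgf_eq_expectation:
  assumes "finite (set_pmf p)"
  shows "pgf p t = measure_pmf.expectation p (\<lambda>m. t ^ m)"
proof -
  have "pgf p t = (\<Sum>m\<in>set_pmf p. pmf p m * t ^ m)"
    unfolding pgf_def using assms by (intro suminf_finite) (auto simp: set_pmf_iff)
  also have "\<dots> = measure_pmf.expectation p (\<lambda>m. t ^ m)"
    using assms by (subst integral_measure_pmf[of "set_pmf p"]) auto
  finally show ?thesis .
qed

text \<open>
  The probability generating functions of the above distributions satisfy the usual initial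
  conditions and recurrence.
\<close>

lemma pgf_swaps_0: "pgf (swaps_pmf {1..0::nat}) t = 1"
  by (simp add: pgf_eq_expectation)

lemma pgf_swaps_1: "pgf (swaps_pmf {1..1::nat}) t = 1"
  by (simp add: pgf_eq_expectation swaps_pmf_def pmf_of_set_singleton swaps_Cons)

lemma pgf_swaps_rec:
  assumes "n \<ge> 2"
  shows "pgf (swaps_pmf {1..n::nat}) t =
           1 / real n * (\<Sum>k=1..n. pgf (swaps_pmf {1..k - 1}) t *
                                   pgf (swaps_pmf {1..n - k}) t * t ^ (k - 1))"
proof -
  let ?E = "measure_pmf.expectation"
  have n: "{1..n} \<noteq> {}" using assms by auto
  have pair: "?E (map_pmf (\<lambda>(c1, c2). m + c1 + c2) (pair_pmf p q)) (\<lambda>m. t ^ m) =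
        ?E p (\<lambda>m. t ^ m) * ?E q (\<lambda>m. t ^ m) * t ^ m"
    if fin: "finite (set_pmf p)" "finite (set_pmf q)" for m and p q :: "nat pmf"
  proof -
    have "?E (map_pmf (\<lambda>(c1, c2). m + c1 + c2) (pair_pmf p q)) (\<lambda>m. t ^ m) =
        (\<Sum>(c1,c2)\<in>set_pmf p \<times> set_pmf q. (pmf p c1 * t ^ c1) * (pmf q c2 * t ^ c2) * t ^ m)"
      using fin
      by (simp, subst integral_measure_pmf[of "set_pmf p \<times> set_pmf q"])
         (auto simp: pmf_pair power_add mult_ac intro!: sum.cong)
    also have "\<dots> = (\<Sum>c1\<in>set_pmf p. pmf p c1 * t ^ c1) * (\<Sum>c2\<in>set_pmf q. pmf q c2 * t ^ c2) * t ^ m"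
      by (subst sum_product) (simp only: sum.cartesian_product sum_distrib_right case_prod_unfold)
    also have "\<dots> = ?E p (\<lambda>m. t ^ m) * ?E q (\<lambda>m. t ^ m) * t ^ m"
      using fin
      by (subst (1 2) integral_measure_pmf[of "set_pmf _"]) auto
    finally show ?thesis .
  qed
  have rec: "swaps_pmf {1..n} = pmf_of_set {1..n} \<bind> (\<lambda>k.
           map_pmf (\<lambda>(c1, c2). (k - 1) + c1 + c2)
             (pair_pmf (swaps_pmf {1..k - 1}) (swaps_pmf {1..n - k})))"
    using swaps_pmf_card_aux[OF _ n swaps_pmf_card] by simp
  have "?E (swaps_pmf {1..n}) (\<lambda>m. t ^ m) =
      (\<Sum>k\<in>{1..n}. ?E (map_pmf (\<lambda>(c1, c2). (k - 1) + c1 + c2)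
             (pair_pmf (swaps_pmf {1..k - 1}) (swaps_pmf {1..n - k}))) (\<lambda>m. t ^ m) /\<^sub>R real n)"
    using n by (subst rec, subst pmf_expectation_bind_pmf_of_set) simp_all
  also have "\<dots> = (\<Sum>k\<in>{1..n}. ?E (swaps_pmf {1..k - 1}) (\<lambda>m. t ^ m) *
         ?E (swaps_pmf {1..n - k}) (\<lambda>m. t ^ m) * t ^ (k - 1) / real n)"
    by (intro sum.cong refl, subst pair) (simp_all add: field_simps)
  finally show ?thesis
    by (simp add: pgf_eq_expectation sum_divide_distrib)
qed

end

theory Submission
  imports Defs
begin

text \<open>
  Let \<open>m\<^sub>n\<close> and \<open>e\<^sub>n\<close> be the first and second moments of the number of swaps. Conditioning on
  the rank \<open>j + 1\<close> of the first pivot writes it as \<open>j + Y + Z\<close> with independent \<open>Y\<close> and \<open>Z\<close>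
  distributed as for lists of lengths \<open>j\<close> and \<open>n - 1 - j\<close>. Taking moments gives
  \<open>n m\<^sub>n = n (n - 1) / 2 + 2 (\<Sum>j<n. m\<^sub>j)\<close>, hence \<open>m\<^sub>n = (n + 1) H\<^sub>1(n) - 2 n\<close>, and
  \<open>n e\<^sub>n = 2 (\<Sum>j<n. e\<^sub>j) + (\<Sum>j<n. j\<^sup>2) + 2 (n - 1) (\<Sum>j<n. m\<^sub>j) + 2 c\<^sub>n\<close>, where
  \<open>c\<^sub>n = (\<Sum>j<n. m\<^sub>j m\<^bsub>n-1-j\<^esub>)\<close>; the two mixed terms \<open>j m\<^sub>j\<close> and \<open>j m\<^bsub>n-1-j\<^esub>\<close> combine because
  reflecting the second sum turns its weight into \<open>n - 1 - j\<close>. Subtracting consecutive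
  instances leaves a first-order recurrence in which the only difficult quantity is
  \<open>c\<^bsub>n+1\<^esub> - c\<^sub>n\<close>.

  This is found with generating functions. With \<open>g = 1 / (1 - x)\<close> and \<open>A = - ln (1 - x)\<close>, the
  generating function of the means is \<open>(A - 1) g\<^sup>2 + g\<close>, so that of \<open>c\<^bsub>n+1\<^esub> - c\<^sub>n\<close> (its square
  divided by \<open>g\<close>) is a combination of powers of \<open>g\<close>, of \<open>A g\<^sup>2\<close>, \<open>A g\<^sup>3\<close>, and \<open>A\<^sup>2 g\<^sup>3\<close>. The
  coefficients of all such products are binomial multiples of polynomials in harmonic numbers
  (lemmas \<open>nth_geo_power\<close>, \<open>nth_logser_geo_power\<close>, \<open>nth_logser_square_geo_power\<close>), and
  this is where \<open>H\<^sub>2\<close> enters. It then only remains to check that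
  the claimed variance plus \<open>m\<^sub>n\<^sup>2\<close> satisfies the recurrence for \<open>e\<^sub>n\<close>.
\<close>

unbundle no vec_syntax
unbundle fps_syntax

section \<open>Harmonic numbers and powers of the geometric series\<close>

lemma H_0 [simp]: "H k 0 = 0"
  by (simp add: H_def)

lemma H_Suc: "H k (Suc n) = H k n + 1 / (real n + 1) ^ k"
  by (simp add: H_def add.commute)

definition geo :: "real fps" where
  "geo = Abs_fps (\<lambda>_. 1)"

text \<open>This is \<open>- ln (1 - x)\<close>; the term at index 0 vanishes because \<open>1 / 0 = 0\<close>.\<close>

definition logser :: "real fps" where
  "logser = Abs_fps (\<lambda>n. 1 / real n)"

lemma fps_nth_mult_geo: "(F * geo) $ n = (\<Sum>i\<le>n. F $ i)"
  by (simp add: geo_def fps_mult_nth atMost_atLeast0)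

text \<open>
  Multiplication by \<open>geo\<close> forms partial sums. This is the Pascal rule that drives the double
  inductions on \<open>m\<close> and \<open>n\<close> for the coefficients below.
\<close>

lemma fps_nth_mult_geo_power_Suc:
  "(F * geo ^ Suc m) $ Suc n = (F * geo ^ Suc m) $ n + (F * geo ^ m) $ Suc n"
proof -
  have "F * geo ^ Suc m = (F * geo ^ m) * geo" by (simp add: mult_ac)
  then show ?thesis by (simp only: fps_nth_mult_geo sum.atMost_Suc)
qed

lemma fps_deriv_logser: "fps_deriv logser = geo"
  by (simp add: fps_eq_iff logser_def geo_def)

lemma binomial_weight:
  "real (Suc (n + Suc m) choose Suc m) * (1 / (real (n + Suc m) + 1))
     = real ((n + Suc m) choose m) * (1 / (real m + 1))"
proof -
  have "Suc m * (Suc (n + Suc m) choose Suc m) = Suc (n + Suc m) * ((n + Suc m) choose m)"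
    by (rule Suc_times_binomial)
  then have "real (Suc m * (Suc (n + Suc m) choose Suc m)) =
      real (Suc (n + Suc m) * ((n + Suc m) choose m))"
    by (rule arg_cong)
  then have "(real m + 1) * real (Suc (n + Suc m) choose Suc m) =
      (real (n + Suc m) + 1) * real ((n + Suc m) choose m)"
    unfolding of_nat_mult by (simp only: of_nat_Suc add.commute)
  then show ?thesis
    by (simp add: divide_simps del: binomial_Suc_Suc of_nat_add) (simp add: mult.commute)
qed

text \<open>
  These two identities are the induction steps for the coefficients of \<open>A g\<^bsup>m+1\<^esup>\<close> and
  \<open>A\<^sup>2 g\<^bsup>m+1\<^esup>\<close>. Here \<open>s\<close> and \<open>a\<close> are two of the three binomial coefficients in Pascal's rule,
  \<open>c\<close> and \<open>d\<close> are the reciprocals by which the harmonic numbers \<open>g\<close> and \<open>h\<close> grow, and the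
  hypothesis is lemma \<open>binomial_weight\<close>. The exponents 1 and 2 are
  the orders of the harmonic numbers.
\<close>

lemma pascal_harmonic:
  fixes a s c d :: real
  assumes "s * d = a * c"
  shows "(s - a) * (h - (g + c ^ 1)) + a * (h - g) = s * (h + d ^ 1 - (g + c ^ 1))"
  using assms by (simp add: algebra_simps)

lemma pascal_harmonic_square:
  fixes a s c d :: real
  assumes "s * d = a * c"
  shows "(s - a) * ((h - (g + c ^ 1))\<^sup>2 - (v - (w + c ^ 2))) + a * ((h - g)\<^sup>2 - (v - w))
     = s * ((h + d ^ 1 - (g + c ^ 1))\<^sup>2 - (v + d ^ 2 - (w + c ^ 2)))"
proof -
  have "s * ((h + d ^ 1 - (g + c ^ 1))\<^sup>2 - (v + d ^ 2 - (w + c ^ 2)))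
     = s * ((h - g)\<^sup>2 - (v - w)) + 2 * (s * d - s * c) * (h - g - c)"
    by (simp add: algebra_simps power2_eq_square)
  then show ?thesis
    unfolding assms by (simp add: algebra_simps power2_eq_square)
qed

lemma nth_geo_power: "(geo ^ Suc m) $ n = real ((n + m) choose m)"
proof (induction m arbitrary: n)
  case 0
  show ?case by (simp add: geo_def)
next
  case (Suc m)
  show ?case
  proof (induction n)
    case 0
    show ?case by (simp add: fps_nth_power_0 geo_def)
  next
    case (Suc n)
    have "(geo ^ Suc (Suc m)) $ Suc n = (geo ^ Suc (Suc m)) $ n + (geo ^ Suc m) $ Suc n"
      using fps_nth_mult_geo_power_Suc[of 1 "Suc m" n] by (simp only: mult_1)
    then show ?case
      by (simp only: Suc.IH \<open>\<And>n. (geo ^ Suc m) $ n = _\<close>) simp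
  qed
qed

lemma nth_logser_geo_power:
  "(logser * geo ^ Suc m) $ n = real ((n + m) choose m) * (H 1 (n + m) - H 1 m)"
proof (induction m arbitrary: n)
  case 0
  show ?case
    by (induction n) (simp_all add: fps_nth_mult_geo logser_def H_Suc add.commute)
next
  case (Suc m)
  note outer = Suc.IH
  show ?case
  proof (induction n)
    case 0
    show ?case by (simp add: logser_def)
  next
    case (Suc n)
    define N where "N = n + Suc m"
    have b: "real (N choose Suc m) = real (Suc N choose Suc m) - real (N choose m)"
      by simp
    have weight: "real (Suc N choose Suc m) * (1 / (real N + 1))
        = real (N choose m) * (1 / (real m + 1))"
      unfolding N_def by (rule binomial_weight)
    have step: "H k (Suc N) = H k N + (1 / (real N + 1)) ^ k"
      "H k (Suc m) = H k m + (1 / (real m + 1)) ^ k" for k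
      by (simp_all add: H_Suc power_one_over)
    have "(logser * geo ^ Suc (Suc m)) $ Suc n =
      real (N choose Suc m) * (H 1 N - H 1 (Suc m)) + real (N choose m) * (H 1 N - H 1 m)"
      by (simp only: fps_nth_mult_geo_power_Suc[of _ "Suc m"] Suc.IH outer)
         (simp add: N_def)
    also have "\<dots> = real (Suc N choose Suc m) * (H 1 (Suc N) - H 1 (Suc m))"
      unfolding step b by (rule pascal_harmonic[OF weight])
    finally show ?case by (simp add: N_def)
  qed
qed

text \<open>Immediate from \<open>(A\<^sup>2)' = 2 A g\<close>, since \<open>A g\<close> generates the harmonic numbers.\<close>

lemma nth_logser_square: "(logser ^ 2) $ Suc n = 2 * H 1 n / (real n + 1)"
proof -
  have "fps_deriv (logser ^ 2) = fps_const 2 * (logser * geo ^ Suc 0)"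
    by (simp add: fps_deriv_power fps_deriv_logser mult_ac)
  then have "fps_deriv (logser ^ 2) $ n = 2 * (logser * geo ^ Suc 0) $ n"
    by (simp only: fps_mult_left_const_nth)
  then show ?thesis
    by (simp only: nth_logser_geo_power fps_deriv_nth) (simp add: field_simps)
qed

text \<open>
  The case \<open>m = 0\<close> sums \<open>2 H\<^sub>1(n) / (n + 1) = H\<^sub>1(n + 1)\<^sup>2 - H\<^sub>1(n)\<^sup>2 - 1 / (n + 1)\<^sup>2\<close>, whose last
  term accumulates to \<open>H\<^sub>2\<close>; larger \<open>m\<close> follow by Pascal's rule.
\<close>

lemma nth_logser_square_geo_power:
  "(logser ^ 2 * geo ^ Suc m) $ n =
     real ((n + m) choose m) * ((H 1 (n + m) - H 1 m)\<^sup>2 - (H 2 (n + m) - H 2 m))"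
proof (induction m arbitrary: n)
  case 0
  show ?case
  proof (induction n)
    case 0
    show ?case by (simp add: fps_nth_power_0 logser_def)
  next
    case (Suc n)
    define d where "d = 1 / (real n + 1)"
    have "H 1 (Suc n) = H 1 n + d" "H 2 (Suc n) = H 2 n + d\<^sup>2"
      by (simp_all add: H_Suc d_def power_one_over)
    moreover have "(logser ^ 2) $ Suc n = 2 * H 1 n * d"
      by (simp add: nth_logser_square d_def)
    ultimately show ?case
      by (simp only: fps_nth_mult_geo_power_Suc[of _ 0] Suc.IH power_0 mult_1_right)
         (simp add: algebra_simps power2_eq_square)
  qed
next
  case (Suc m)
  note outer = Suc.IH
  show ?case
  proof (induction n)
    case 0
    show ?case by (simp add: fps_nth_power_0 logser_def)
  next
    case (Suc n)
    define N where "N = n + Suc m"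
    have b: "real (N choose Suc m) = real (Suc N choose Suc m) - real (N choose m)"
      by simp
    have weight: "real (Suc N choose Suc m) * (1 / (real N + 1))
        = real (N choose m) * (1 / (real m + 1))"
      unfolding N_def by (rule binomial_weight)
    have step: "H k (Suc N) = H k N + (1 / (real N + 1)) ^ k"
      "H k (Suc m) = H k m + (1 / (real m + 1)) ^ k" for k
      by (simp_all add: H_Suc power_one_over)
    have "(logser ^ 2 * geo ^ Suc (Suc m)) $ Suc n =
      real (N choose Suc m) * ((H 1 N - H 1 (Suc m))\<^sup>2 - (H 2 N - H 2 (Suc m)))
      + real (N choose m) * ((H 1 N - H 1 m)\<^sup>2 - (H 2 N - H 2 m))"
      by (simp only: fps_nth_mult_geo_power_Suc[of _ "Suc m"] Suc.IH outer)
         (simp add: N_def)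
    also have "\<dots> = real (Suc N choose Suc m) *
        ((H 1 (Suc N) - H 1 (Suc m))\<^sup>2 - (H 2 (Suc N) - H 2 (Suc m)))"
      unfolding step b by (rule pascal_harmonic_square[OF weight])
    finally show ?case by (simp add: N_def)
  qed
qed

section \<open>The recurrences for the first two moments\<close>

text \<open>The closed form of the expected number of swaps, identified as such in lemma \<open>moment_1\<close>.\<close>

definition mean :: "nat \<Rightarrow> real" where
  "mean n = (real n + 1) * H 1 n - 2 * real n"

lemma mean_fps: "Abs_fps mean = (logser - 1) * geo ^ 2 + geo"
proof (rule fps_ext)
  fix n
  have "((logser - 1) * geo ^ 2 + geo) $ n =
    (logser * geo ^ Suc 1) $ n - (geo ^ Suc 1) $ n + (geo ^ Suc 0) $ n"
    by (simp add: algebra_simps numeral_2_eq_2)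
  also have "\<dots> = mean n"
    by (simp only: nth_logser_geo_power nth_geo_power) (simp add: mean_def H_Suc field_simps)
  finally show "Abs_fps mean $ n = ((logser - 1) * geo ^ 2 + geo) $ n" by simp
qed

definition conv :: "nat \<Rightarrow> real" where
  "conv n = (\<Sum>j<n. mean j * mean (n - 1 - j))"

text \<open>
  The increment rather than \<open>conv\<close> itself is computed: it suffices for the recurrence, and
  it lowers the power of the geometric series from four to three. The constants
  \<open>3 / 2\<close> and \<open>5 / 4\<close> are \<open>H 1 2\<close> and \<open>H 2 2\<close>.
\<close>

lemma conv_Suc:
  "conv (Suc n) = conv n + (real n + 1) * (real n + 2) / 2 *
     ((H 1 (n + 2) - 3 / 2)\<^sup>2 - (H 2 (n + 2) - 5 / 4) - 2 * (H 1 (n + 2) - 3 / 2) + 1)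
   + 2 * (real n + 1) * (H 1 (n + 1) - 2) + 1"
proof -
  \<comment> \<open>\<open>W * geo\<close> is the square of the generating function of the means.\<close>
  define W where "W = logser ^ 2 * geo ^ 3 - 2 * (logser * geo ^ 3) + geo ^ 3
     + 2 * (logser * geo ^ 2) - 2 * geo ^ 2 + geo"
  have conv: "conv (Suc k) = (W * geo) $ k" for k
  proof -
    have "conv (Suc k) = (Abs_fps mean ^ 2) $ k"
      by (simp add: conv_def power2_eq_square fps_mult_nth lessThan_Suc_atMost atMost_atLeast0)
    also have "Abs_fps mean ^ 2 = W * geo"
      unfolding mean_fps W_def by (simp add: algebra_simps power2_eq_square power3_eq_cube)
    finally show ?thesis .
  qed
  have geo_0: "geo $ 0 = 1" by (simp add: geo_def)
  have conv_0: "conv 0 = 0" by (simp add: conv_def)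
  have "conv (Suc n) = conv n + W $ n"
    by (cases n) (simp_all add: conv fps_nth_mult_geo conv_0 geo_0)
  moreover have "W $ n = (logser ^ 2 * geo ^ Suc 2) $ n - 2 * (logser * geo ^ Suc 2) $ n
     + (geo ^ Suc 2) $ n + 2 * (logser * geo ^ Suc 1) $ n - 2 * (geo ^ Suc 1) $ n + (geo ^ Suc 0) $ n"
    by (simp add: W_def numeral_2_eq_2 numeral_3_eq_3 numeral_fps_const)
  moreover have "real ((n + 2) choose 2) = (real n + 1) * (real n + 2) / 2"
    by (induction n) (simp_all add: numeral_2_eq_2 field_simps)
  moreover have "H 1 2 = 3/2" "H 2 2 = 5/4" "H 1 1 = 1"
    by (simp_all add: H_def numeral_2_eq_2)
  ultimately show ?thesis
    by (simp only: nth_logser_geo_power nth_geo_power nth_logser_square_geo_power)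
       (simp add: field_simps)
qed

text \<open>The recurrence for the means after eliminating the sum over all smaller lengths.\<close>

lemma mean_Suc: "(real n + 1) * mean (Suc n) = (real n + 2) * mean n + real n"
  by (simp add: mean_def H_Suc field_simps)

lemma mean_recurrence_unique:
  fixes m :: "nat \<Rightarrow> real"
  assumes rec: "\<And>n. real n * m n = real n * (real n - 1) / 2 + 2 * (\<Sum>j<n. m j)"
    and m0: "m 0 = 0"
  shows "m n = mean n"
proof (induction n)
  case 0
  show ?case by (simp add: m0 mean_def)
next
  case (Suc n)
  have "(real n + 1) * m (Suc n) = (real n + 2) * m n + real n"
    using rec[of "Suc n"] rec[of n] by (simp add: field_simps)
  also have "\<dots> = (real n + 1) * mean (Suc n)"
    by (simp only: Suc.IH mean_Suc)
  finally show ?case by simp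
qed

text \<open>
  Subtracting the recurrences for \<open>n + 1\<close> and \<open>n\<close> removes the sum over \<open>e\<close> and leaves
  \<open>(n + 1) e\<^bsub>n+1\<^esub> = (n + 2) e\<^sub>n + \<dots>\<close>, so ordinary induction suffices.
\<close>

lemma second_moment_recurrence_unique:
  fixes e :: "nat \<Rightarrow> real"
  assumes rec: "\<And>n. real n * e n = 2 * (\<Sum>j<n. e j) + (\<Sum>j<n. (real j)\<^sup>2)
      + real n * (real n - 1) * (mean n - (real n - 1) / 2) + 2 * conv n"
    and e0: "e 0 = 0"
  shows "e n = 2 * real n * (real n + 2) - (real n + 1) * H 1 n - (real n + 1)\<^sup>2 * H 2 n
      + (mean n)\<^sup>2" (is "_ = ?E n")
proof (induction n)
  case 0
  show ?case by (simp add: e0 mean_def)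
next
  case (Suc n)
  have "(real n + 1) * e (Suc n) = (real n + 2) * e n + (real n)\<^sup>2
     + real n * (real n + 1) * (mean (Suc n) - real n / 2)
     - real n * (real n - 1) * (mean n - (real n - 1) / 2) + 2 * (conv (Suc n) - conv n)"
    using rec[of "Suc n"] rec[of n] by (simp add: algebra_simps)
  also have "\<dots> = (real n + 1) * ?E (Suc n)"
  proof -
    \<comment> \<open>With \<open>a\<close> and \<open>b\<close> constrained only by \<open>ua\<close> and \<open>ub\<close>, the goal is a polynomial identity
      modulo two polynomial relations, without any division.\<close>
    define h k where "h = H 1 n" and "k = H 2 n"
    define u a b where "u = real n + 1" and "a = 1 / u" and "b = 1 / (u + 1)"
    have n: "real n = u - 1" by (simp add: u_def)
    have "u > 0" by (simp add: u_def)
    then have ua: "u * a = 1" and ub: "(u + 1) * b = 1" by (simp_all add: a_def b_def)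
    have H1: "H 1 (Suc n) = h + a" "H 1 (n + 2) = h + a + b"
      and H2: "H 2 (Suc n) = k + a\<^sup>2" "H 2 (n + 2) = k + a\<^sup>2 + b\<^sup>2"
      by (simp_all add: h_def k_def a_def b_def u_def H_Suc numeral_2_eq_2 add_ac power_one_over)
    show ?thesis
      unfolding Suc.IH conv_Suc mean_def Suc_eq_plus1[symmetric] H1 H2 h_def[symmetric] k_def[symmetric]
        of_nat_Suc n
      using ua ub by algebra
  qed
  finally show ?case by simp
qed

section \<open>The moments of the number of swaps\<close>

lemma expectation_pair_prod:
  fixes f :: "'a \<Rightarrow> real" and g :: "'b \<Rightarrow> real"
  assumes fin: "finite (set_pmf p)" "finite (set_pmf q)"
  shows "measure_pmf.expectation (pair_pmf p q) (\<lambda>z. f (fst z) * g (snd z)) =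
     measure_pmf.expectation p f * measure_pmf.expectation q g"
proof -
  have "measure_pmf.expectation (pair_pmf p q) (\<lambda>z. f (fst z) * g (snd z)) =
      (\<Sum>z\<in>set_pmf p \<times> set_pmf q. (pmf p (fst z) * f (fst z)) * (pmf q (snd z) * g (snd z)))"
    using fin by (subst integral_measure_pmf[of "set_pmf p \<times> set_pmf q"])
         (auto simp: pmf_pair mult_ac intro!: sum.cong)
  also have "\<dots> = (\<Sum>a\<in>set_pmf p. pmf p a * f a) * (\<Sum>b\<in>set_pmf q. pmf q b * g b)"
    by (subst sum_product) (simp only: sum.cartesian_product case_prod_unfold)
  also have "\<dots> = measure_pmf.expectation p f * measure_pmf.expectation q g"
    using fin by (subst (1 2) integral_measure_pmf[of "set_pmf _"]) auto
  finally show ?thesis .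
qed

definition moment :: "nat \<Rightarrow> nat \<Rightarrow> real" where
  "moment r n = measure_pmf.expectation (swaps_pmf {1..n::nat}) (\<lambda>x. real x ^ r)"

lemma moment_0: "moment 0 n = 1"
  by (simp add: moment_def)

lemma moment_at_0: "r > 0 \<Longrightarrow> moment r 0 = 0"
  by (simp add: moment_def)

lemma expectation_swaps_pair:
  "measure_pmf.expectation (pair_pmf (swaps_pmf {1..i::nat}) (swaps_pmf {1..j::nat}))
     (\<lambda>z. real (fst z) ^ r * real (snd z) ^ s) = moment r i * moment s j"
  unfolding moment_def by (rule expectation_pair_prod) simp_all

text \<open>
  Conditioning on the pivot, \<open>j\<close> being the number of elements below it. Multiplying by \<open>n\<close>
  keeps the empty list as a (trivial) instance, so the recurrences need no case distinction.
\<close>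

lemma moment_recurrence:
  "real n * moment r n = (\<Sum>j<n. measure_pmf.expectation
     (pair_pmf (swaps_pmf {1..j::nat}) (swaps_pmf {1..n - 1 - j::nat}))
     (\<lambda>z. (real j + real (fst z) + real (snd z)) ^ r))"
proof (cases "n = 0")
  case False
  let ?E = "measure_pmf.expectation"
  have n: "{1..n} \<noteq> {}" using False by auto
  have rec: "swaps_pmf {1..n} = pmf_of_set {1..n} \<bind> (\<lambda>k.
           map_pmf (\<lambda>(c1, c2). (k - 1) + c1 + c2)
             (pair_pmf (swaps_pmf {1..k - 1}) (swaps_pmf {1..n - k})))"
    using swaps_pmf_card_aux[OF _ n swaps_pmf_card] by simp
  have "moment r n =
      (\<Sum>k\<in>{1..n}. ?E (map_pmf (\<lambda>(c1, c2). (k - 1) + c1 + c2)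
        (pair_pmf (swaps_pmf {1..k - 1}) (swaps_pmf {1..n - k}))) (\<lambda>x. real x ^ r) /\<^sub>R real n)"
    unfolding moment_def
    using n by (subst rec, subst pmf_expectation_bind_pmf_of_set) simp_all
  then show ?thesis
    using False
    by (simp add: sum.atLeast1_atMost_eq case_prod_unfold add.assoc divide_inverse_commute
          flip: sum_divide_distrib sum_distrib_left)
qed simp

lemma integrable_swaps_pair [simp]:
  fixes f :: "_ \<Rightarrow> real"
  shows "integrable (pair_pmf (swaps_pmf {1..i::nat}) (swaps_pmf {1..j::nat})) f"
  by (rule integrable_measure_pmf_finite) simp

lemma moment_1: "moment 1 n = mean n"
proof (rule mean_recurrence_unique)
  fix n
  let ?P = "\<lambda>j. pair_pmf (swaps_pmf {1..j::nat}) (swaps_pmf {1..n - 1 - j::nat})"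
  \<comment> \<open>The powers 0 and 1 put every summand into the form required by \<open>expectation_swaps_pair\<close>.\<close>
  have "real n * moment 1 n = (\<Sum>j<n. measure_pmf.expectation (?P j)
      (\<lambda>z. real j + real (fst z) ^ 1 * real (snd z) ^ 0 + real (fst z) ^ 0 * real (snd z) ^ 1))"
    by (subst moment_recurrence) simp
  also have "\<dots> = (\<Sum>j<n. real j + moment 1 j + moment 1 (n - 1 - j))"
    by (simp only: Bochner_Integration.integral_add integrable_swaps_pair
          expectation_swaps_pair moment_0) simp
  also have "\<dots> = (\<Sum>j<n. real j) + 2 * (\<Sum>j<n. moment 1 j)"
    by (simp add: sum.distrib sum.nat_diff_reindex[of "moment _"])
  also have "(\<Sum>j<n. real j) = real n * (real n - 1) / 2"
    by (induction n) (simp_all add: field_simps)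
  finally show "real n * moment 1 n = real n * (real n - 1) / 2 + 2 * (\<Sum>j<n. moment 1 j)" .
qed (simp add: moment_at_0)

lemma sum_mean: "2 * (\<Sum>j<n. mean j) = real n * (mean n - (real n - 1) / 2)"
proof (induction n)
  case (Suc n)
  then show ?case
    using mean_Suc[of n] by (simp add: field_simps)
qed simp

lemma moment_2:
  "moment 2 n = 2 * real n * (real n + 2) - (real n + 1) * H 1 n - (real n + 1)\<^sup>2 * H 2 n
     + (mean n)\<^sup>2"
proof (rule second_moment_recurrence_unique)
  fix n
  let ?P = "\<lambda>j. pair_pmf (swaps_pmf {1..j::nat}) (swaps_pmf {1..n - 1 - j::nat})"
  have "real n * moment 2 n = (\<Sum>j<n. measure_pmf.expectation (?P j)
      (\<lambda>z. (real j)\<^sup>2 + real (fst z) ^ 2 * real (snd z) ^ 0 + real (fst z) ^ 0 * real (snd z) ^ 2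
        + 2 * real j * (real (fst z) ^ 1 * real (snd z) ^ 0)
        + 2 * real j * (real (fst z) ^ 0 * real (snd z) ^ 1)
        + 2 * (real (fst z) ^ 1 * real (snd z) ^ 1)))"
    by (subst moment_recurrence) (simp add: power2_eq_square algebra_simps)
  also have "\<dots> = (\<Sum>j<n. (real j)\<^sup>2 + moment 2 j + moment 2 (n - 1 - j)
      + 2 * real j * mean j + 2 * real j * mean (n - 1 - j) + 2 * (mean j * mean (n - 1 - j)))"
    by (simp only: Bochner_Integration.integral_add integrable_swaps_pair
          integral_mult_right_zero expectation_swaps_pair moment_0 moment_1) simp
  also have "\<dots> = (\<Sum>j<n. (real j)\<^sup>2) + 2 * (\<Sum>j<n. moment 2 j)
      + (\<Sum>j<n. 2 * real j * mean j) + (\<Sum>j<n. 2 * real j * mean (n - 1 - j)) + 2 * conv n"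
    by (simp add: sum.distrib sum.nat_diff_reindex[of "moment _"] conv_def sum_distrib_left)
  also have "(\<Sum>j<n. 2 * real j * mean (n - 1 - j)) = (\<Sum>j<n. 2 * real (n - 1 - j) * mean j)"
    by (subst sum.nat_diff_reindex[symmetric]) (intro sum.cong, auto)
  also have "\<dots> = (\<Sum>j<n. 2 * (real n - 1) * mean j) - (\<Sum>j<n. 2 * real j * mean j)"
    by (simp add: of_nat_diff algebra_simps flip: sum_subtractf)
  also have "(\<Sum>j<n. 2 * (real n - 1) * mean j) = (real n - 1) * (2 * (\<Sum>j<n. mean j))"
    by (simp add: sum_distrib_left mult_ac)
  finally show "real n * moment 2 n = 2 * (\<Sum>j<n. moment 2 j) + (\<Sum>j<n. (real j)\<^sup>2)
      + real n * (real n - 1) * (mean n - (real n - 1) / 2) + 2 * conv n"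
    by (simp add: sum_mean mult_ac)
qed (simp add: moment_at_0)

theorem theorem4p6:
  fixes A :: "'a::linorder set" and n :: nat
  assumes "n \<ge> 1" and "finite A" and "card A = n"
  shows "measure_pmf.variance (swaps_pmf A) real =
           2 * real n * (real n + 2) - (real n + 1) * H 1 n - (real n + 1)\<^sup>2 * H 2 n"
proof -
  have "measure_pmf.variance (swaps_pmf A) real = moment 2 n - (moment 1 n)\<^sup>2"
    unfolding swaps_pmf_card[OF assms(2)] assms(3) moment_def
    by (subst measure_pmf.variance_eq) (simp_all add: integrable_measure_pmf_finite)
  then show ?thesis
    by (simp add: moment_1[unfolded One_nat_def] moment_2)
qed

end
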